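(* The following statements about the real field $\mathbb{R}$ are equivalent. (1) [AP & weak NIP] The conjunction of the Archimedean Principle: for any $x>0$ and any $y>0$, there exists $N\in\mathbb{N}$ such that $N>\frac{x}{y}$; and the Weak Nested Intervals Principle: if $(I_k)_{k\in\mathbb{N}}$ is a sequence of nested intervals and $\lim_{k\to\infty}\ell(I_k)=0$, then $\bigcap_{k=1}^\infty I_k\neq\emptyset$. (2) [ES] Existence of Suprema: every nonempty set of real numbers that has an upper bound has a least upper bound. (3) The unit interval $[0,1]$ is connected. (4) The set $\mathbb{R}$ is not totally disconnected. (5) All intervals are connected. (6) [IVT] Intermediate Value Theorem: given a continuous function $f:[a,b]\to\mathbb{R}$, if $f(a)<k<f(b)$, then there exists $c\in[a,b]$ such that $f(c)=k$. (7) The set $\mathbb{R}$ is connected. (8) [CA] Dedekind's Cut Axiom: every cut of $\mathbb{R}$ is not a gap. (9) [MCP] Monotone Convergence Principle: a monotonically increasing sequence that is bounded above is convergent.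
   Context: The setting is the real field $\mathbb{R}$; any one of the listed principles may be chosen as the completeness axiom for $\mathbb{R}$, and equivalence means that each principle is derived from each other one. $\mathbb{N}=\{1,2,3,\dots\}$. A sequence is a function $\mathbb{N}\to\mathbb{R}$, $(c_n)_{n\in\mathbb{N}}$; it is monotonically increasing if $c_n\le c_{n+1}$ for all $n$, bounded above if some $M\in\mathbb{R}$ satisfies $c_n\le M$ for all $n$, and converges to $c\in\mathbb{R}$ if for every $\varepsilon>0$ there is $N\in\mathbb{N}$ with $|c_n-c|<\varepsilon$ for all $n\ge N$ (convergent: converges to some $c\in\mathbb{R}$). A sequence of nested intervals is a sequence $(I_k)_{k\in\mathbb{N}}$ of nonempty closed and bounded intervals $I_k=[a_k,b_k]$ with $I_{k+1}\subseteq I_k$ for all $k$; $\ell([a,b])=b-a$. An upper bound of $S\subseteq\mathbb{R}$ is $b\in\mathbb{R}$ with $x\le b$ for all $x\in S$; a least upper bound is an upper bound $c$ with $c\le b$ for every upper bound $b$. If $I\subseteq\mathbb{R}$ is an interval and $a,b\in I$ with $a<b$, then $[a,b]\subseteq I$; intervals are the sets with this property. $G\subseteq\mathbb{R}$ is open if for every $x\in G$ there is a bounded open interval $(a,b)$ with $x\in(a,b)\subseteq G$. For $U\subseteq I\subseteq\mathbb{R}$, $U$ is open relative to $I$ if $U=G\cap I$ for some open $G$. A set $I\subseteq\mathbb{R}$ is connected if there do not exist nonempty disjoint subsets $A,B$ of $I$, both open relative to $I$, with $I=A\cup B$. A subset of $\mathbb{R}$ is totally disconnected if each of its nonempty connected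 subsets is a singleton. A function $f:I\to\mathbb{R}$ is continuous if for each $c\in I$ and each $\varepsilon>0$ there is $\delta>0$ such that $x\in I$, $|x-c|<\delta$ imply $|f(x)-f(c)|<\varepsilon$. A cut of $\mathbb{R}$ is a nonempty proper subset $A$ of $\mathbb{R}$ such that $a<b$ for each $a\in A$ and each $b\in A^c=\mathbb{R}\setminus A$. A cut $A$ is a gap if for every $c\in\mathbb{R}$ there exist $a\in A$ and $b\in A^c$ such that $c\notin[a,b]$. *)

theory Defs
  imports "HOL-Analysis.Analysis" "HOL-Library.Lub_Glb"
begin

text \<open>
  None of the principles may be presupposed, so all of them are stated for an arbitrary linearly
  ordered field. The topological and metric notions of the real numbers are therefore not available:
  the topology is the one below, and limits and continuity are given by
  \<open>\<epsilon>\<close>-\<open>\<delta>\<close> conditions in which \<open>\<epsilon>\<close> and \<open>\<delta>\<close> range over the field itself. Each principle takes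
  the field as a \<open>TYPE('a)\<close> argument. Sequences are indexed from 0.
\<close>

definition interval_open :: "'a::linordered_field set \<Rightarrow> bool" where
  "interval_open G \<longleftrightarrow> (\<forall>x\<in>G. \<exists>a b. x \<in> {a<..<b} \<and> {a<..<b} \<subseteq> G)"

definition interval_topology :: "'a::linordered_field topology" where
  "interval_topology = topology interval_open"

lemma istopology_interval_open: "istopology interval_open"
  unfolding istopology_def
proof (intro conjI allI impI)
  fix S T :: "'a set"
  assume ST: "interval_open S" "interval_open T"
  show "interval_open (S \<inter> T)"
    unfolding interval_open_def
  proof
    fix x assume x: "x \<in> S \<inter> T"
    obtain a b where ab: "x \<in> {a<..<b}" "{a<..<b} \<subseteq> S"
      using ST x unfolding interval_open_def by blast
    obtain c d where cd: "x \<in> {c<..<d}" "{c<..<d} \<subseteq> T"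
      using ST x unfolding interval_open_def by blast
    have "x \<in> {max a c<..<min b d}" "{max a c<..<min b d} \<subseteq> S \<inter> T"
      using ab cd by auto
    then show "\<exists>a b. x \<in> {a<..<b} \<and> {a<..<b} \<subseteq> S \<inter> T" by blast
  qed
next
  fix K :: "'a set set"
  assume "\<forall>S\<in>K. interval_open S"
  then show "interval_open (\<Union>K)"
    unfolding interval_open_def by (meson Union_iff Union_upper subset_trans)
qed

lemma openin_interval_topology: "openin interval_topology G \<longleftrightarrow> interval_open G"
  by (simp add: interval_topology_def istopology_interval_open topology_inverse')

lemma topspace_interval_topology [simp]: "topspace interval_topology = UNIV"
proof -
  have "interval_open (UNIV :: 'a set)"
    unfolding interval_open_def by (auto intro: gt_ex lt_ex)
  then show ?thesis
    using openin_interval_topology openin_subset by blast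
qed

text \<open>The library's \<^const>\<open>connectedin\<close>, unfolded for this topology.\<close>

lemma connectedin_interval_topology:
  "connectedin interval_topology I \<longleftrightarrow>
     \<not> (\<exists>A B. A \<noteq> {} \<and> B \<noteq> {} \<and> A \<inter> B = {} \<and> I = A \<union> B \<and>
          (\<exists>G. interval_open G \<and> A = G \<inter> I) \<and> (\<exists>G. interval_open G \<and> B = G \<inter> I))"
proof -
  have "(\<exists>E1 E2. openin (subtopology interval_topology I) E1 \<and>
          openin (subtopology interval_topology I) E2 \<and>
          topspace (subtopology interval_topology I) \<subseteq> E1 \<union> E2 \<and>
          E1 \<inter> E2 = {} \<and> E1 \<noteq> {} \<and> E2 \<noteq> {}) \<longleftrightarrow>
        (\<exists>A B. A \<noteq> {} \<and> B \<noteq> {} \<and> A \<inter> B = {} \<and> I = A \<union> B \<and>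
          (\<exists>G. interval_open G \<and> A = G \<inter> I) \<and> (\<exists>G. interval_open G \<and> B = G \<inter> I))"
    (is "(\<exists>A B. ?L A B) \<longleftrightarrow> (\<exists>A B. ?R A B)")
  proof -
    have "?L A B = ?R A B" for A B
      unfolding openin_subtopology openin_interval_topology by auto
    then show ?thesis by simp
  qed
  then show ?thesis
    unfolding connectedin_def connected_space_def by simp
qed

definition totally_disconnected :: "'a::linordered_field set \<Rightarrow> bool" where
  "totally_disconnected S \<longleftrightarrow>
     (\<forall>C. C \<subseteq> S \<and> C \<noteq> {} \<and> connectedin interval_topology C \<longrightarrow> is_singleton C)"

definition interval_set :: "'a::linordered_field set \<Rightarrow> bool" where
  "interval_set I \<longleftrightarrow> (\<forall>a\<in>I. \<forall>b\<in>I. a < b \<longrightarrow> {a..b} \<subseteq> I)"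

definition converges_to :: "(nat \<Rightarrow> 'a::linordered_field) \<Rightarrow> 'a \<Rightarrow> bool" where
  "converges_to c l \<longleftrightarrow> (\<forall>\<epsilon>>0. \<exists>N. \<forall>n\<ge>N. \<bar>c n - l\<bar> < \<epsilon>)"

definition field_continuous_on :: "'a::linordered_field set \<Rightarrow> ('a \<Rightarrow> 'a) \<Rightarrow> bool" where
  "field_continuous_on I f \<longleftrightarrow>
     (\<forall>c\<in>I. \<forall>\<epsilon>>0. \<exists>\<delta>>0. \<forall>x\<in>I. \<bar>x - c\<bar> < \<delta> \<longrightarrow> \<bar>f x - f c\<bar> < \<epsilon>)"

definition nested_intervals ::
  "(nat \<Rightarrow> 'a::linordered_field) \<Rightarrow> (nat \<Rightarrow> 'a) \<Rightarrow> bool" where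
  "nested_intervals a b \<longleftrightarrow>
     (\<forall>k. a k \<le> b k) \<and> (\<forall>k. {a (Suc k)..b (Suc k)} \<subseteq> {a k..b k})"

definition is_cut :: "'a::linordered_field set \<Rightarrow> bool" where
  "is_cut A \<longleftrightarrow> A \<noteq> {} \<and> A \<noteq> UNIV \<and> (\<forall>a\<in>A. \<forall>b\<in>-A. a < b)"

definition is_gap :: "'a::linordered_field set \<Rightarrow> bool" where
  "is_gap A \<longleftrightarrow> is_cut A \<and> (\<forall>c. \<exists>a\<in>A. \<exists>b\<in>-A. c \<notin> {a..b})"

definition archimedean_principle :: "'a::linordered_field itself \<Rightarrow> bool" where
  "archimedean_principle _ \<longleftrightarrow>
     (\<forall>x y :: 'a. x > 0 \<and> y > 0 \<longrightarrow> (\<exists>N::nat. N \<ge> 1 \<and> of_nat N > x / y))"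

definition weak_nested_intervals_principle :: "'a::linordered_field itself \<Rightarrow> bool" where
  "weak_nested_intervals_principle _ \<longleftrightarrow>
     (\<forall>a b :: nat \<Rightarrow> 'a. nested_intervals a b \<and> converges_to (\<lambda>k. b k - a k) 0
        \<longrightarrow> (\<Inter>k. {a k..b k}) \<noteq> {})"

definition existence_of_suprema :: "'a::linordered_field itself \<Rightarrow> bool" where
  "existence_of_suprema _ \<longleftrightarrow>
     (\<forall>S :: 'a set. S \<noteq> {} \<and> (\<exists>b. isUb UNIV S b) \<longrightarrow> (\<exists>c. isLub UNIV S c))"

definition intermediate_value_theorem :: "'a::linordered_field itself \<Rightarrow> bool" where
  "intermediate_value_theorem _ \<longleftrightarrow>
     (\<forall>(a::'a) b f k. a \<le> b \<and> field_continuous_on {a..b} f \<and> f a < k \<and> k < f b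
        \<longrightarrow> (\<exists>c\<in>{a..b}. f c = k))"

definition cut_axiom :: "'a::linordered_field itself \<Rightarrow> bool" where
  "cut_axiom _ \<longleftrightarrow> (\<forall>A :: 'a set. is_cut A \<longrightarrow> \<not> is_gap A)"

definition monotone_convergence_principle :: "'a::linordered_field itself \<Rightarrow> bool" where
  "monotone_convergence_principle _ \<longleftrightarrow>
     (\<forall>c :: nat \<Rightarrow> 'a. (\<forall>n. c n \<le> c (Suc n)) \<and> (\<exists>M. \<forall>n. c n \<le> M)
        \<longrightarrow> (\<exists>l. converges_to c l))"

end

theory Submission
  imports Defs
begin

text \<open>
  Every principle is compared with the cut axiom, because a gap is the one object that all of them
  exclude.

  A gap \<open>A\<close> splits the field into two nonempty open pieces (\<open>interval_open_gap\<close>,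
  \<open>interval_open_compl_gap\<close>). An affine map moves a gap anywhere in the field, in particular between
  any two given points (\<open>gap_between\<close>); so a single gap disconnects every set with at least two
  points (\<open>gap_imp_not_connectedin\<close>). This is why connectedness of one nontrivial set, be it the
  unit interval, the whole field or some unspecified set, already excludes all gaps.
  A step function that jumps across a gap is continuous and omits the values in between
  (\<open>intermediate_value_theorem_imp_cut_axiom\<close>), so the intermediate value theorem excludes gaps too.

  Conversely, from a separation of an interval one reads off a cut at the first place where one
  piece is left, and the point that fills this cut can belong to neither of the pieces
  (\<open>cut_axiom_imp_interval_connected\<close>). The intermediate value theorem then follows, since a
  continuous function that omits \<open>k\<close> separates its domain into \<open>f < k\<close> and \<open>f > k\<close>.

  On the order-theoretic side, a supremum of \<open>S\<close> is the same as a point filling the cut of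
  those elements that are not upper bounds of \<open>S\<close>. Suprema give limits of bounded increasing
  sequences. Monotone convergence yields the Archimedean principle, because a limit
  of the sequence \<open>0, 1, 2, \<dots>\<close> cannot exist, and it yields nested intervals through the limit of the left
  endpoints. The circle closes by bisecting a cut; the Archimedean principle makes the lengths
  \<open>d / 2\<^sup>k\<close> tend to zero.
\<close>

section \<open>Gaps and connectedness\<close>

lemma cut_downward_closed:
  assumes "is_cut A" "a \<in> A" "x \<le> a"
  shows "x \<in> A"
  using assms unfolding is_cut_def by (metis ComplI leD)

lemma gap_greater_in:
  assumes "is_gap A" "c \<in> A"
  obtains a where "a \<in> A" "c < a"
proof -
  obtain a b where ab: "a \<in> A" "b \<in> -A" "c \<notin> {a..b}"
    using assms(1) unfolding is_gap_def by blast
  moreover have "c < b"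
    using assms ab(2) unfolding is_gap_def is_cut_def by blast
  ultimately show thesis using that by auto
qed

lemma gap_less_out:
  assumes "is_gap A" "c \<notin> A"
  obtains b where "b \<notin> A" "b < c"
proof -
  obtain a b where ab: "a \<in> A" "b \<in> -A" "c \<notin> {a..b}"
    using assms(1) unfolding is_gap_def by blast
  moreover have "a < c"
    using assms ab(1) unfolding is_gap_def is_cut_def by blast
  ultimately show thesis using that by auto
qed

lemma interval_open_gap:
  assumes "is_gap A"
  shows "interval_open A"
  unfolding interval_open_def
proof
  fix x assume "x \<in> A"
  then obtain a where a: "a \<in> A" "x < a" using gap_greater_in assms by blast
  have "{x - 1<..<a} \<subseteq> A"
    using cut_downward_closed a(1) assms unfolding is_gap_def by fastforce
  then show "\<exists>l r. x \<in> {l<..<r} \<and> {l<..<r} \<subseteq> A"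
    using a by (intro exI[of _ "x - 1"] exI[of _ a]) auto
qed

lemma interval_open_compl_gap:
  assumes "is_gap A"
  shows "interval_open (-A)"
  unfolding interval_open_def
proof
  fix x assume "x \<in> -A"
  then obtain b where b: "b \<notin> A" "b < x" using gap_less_out assms by blast
  have "{b<..<x + 1} \<subseteq> -A"
    using cut_downward_closed b(1) assms unfolding is_gap_def by fastforce
  then show "\<exists>l r. x \<in> {l<..<r} \<and> {l<..<r} \<subseteq> -A"
    using b by (intro exI[of _ b] exI[of _ "x + 1"]) auto
qed

text \<open>
  Take \<open>a \<in> A\<close> and \<open>b \<notin> A\<close>. The increasing affine bijection that sends \<open>p\<close> to \<open>a\<close> and \<open>q\<close> to
  \<open>b\<close> pulls the gap back to one between \<open>p\<close> and \<open>q\<close>.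
\<close>

lemma gap_between:
  fixes p q :: "'a::linordered_field"
  assumes gap: "is_gap (A :: 'a set)" and "p < q"
  obtains A' where "is_gap A'" "p \<in> A'" "q \<notin> A'"
proof -
  obtain a b where ab: "a \<in> A" "b \<notin> A"
    using gap unfolding is_gap_def is_cut_def by blast
  then have "a < b" using gap unfolding is_gap_def is_cut_def by blast
  define s where "s = (b - a) / (q - p)"
  have s: "s > 0" using \<open>a < b\<close> \<open>p < q\<close> by (simp add: s_def)
  define g where "g x = a + (x - p) * s" for x
  define h where "h y = p + (y - a) / s" for y
  have gh [simp]: "g (h y) = y" for y using s by (simp add: g_def h_def)
  have less_iff: "g x < g y \<longleftrightarrow> x < y" for x y using s by (simp add: g_def)
  have le_iff: "g x \<le> g y \<longleftrightarrow> x \<le> y" for x y using s by (simp add: g_def)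
  have gp: "g p = a" by (simp add: g_def)
  have gq: "g q = b" using \<open>p < q\<close> by (simp add: g_def s_def)
  define A' where "A' = g -` A"
  have "is_cut A'"
    unfolding is_cut_def
  proof (intro conjI ballI)
    show "A' \<noteq> {}" "A' \<noteq> UNIV" using ab gp gq by (auto simp: A'_def)
    fix x y assume "x \<in> A'" "y \<in> -A'"
    then have "g x < g y"
      using gap unfolding is_gap_def is_cut_def A'_def by auto
    then show "x < y" by (simp add: less_iff)
  qed
  moreover have "\<exists>x\<in>A'. \<exists>y\<in>-A'. c \<notin> {x..y}" for c
  proof -
    obtain u v where uv: "u \<in> A" "v \<in> -A" "g c \<notin> {u..v}"
      using gap unfolding is_gap_def by blast
    then have "h u \<in> A'" "h v \<in> -A'" by (auto simp: A'_def)
    moreover have "c \<notin> {h u..h v}"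
      using uv(3) le_iff[of "h u" c] le_iff[of c "h v"] by auto
    ultimately show ?thesis by blast
  qed
  ultimately have "is_gap A'" unfolding is_gap_def by blast
  moreover have "p \<in> A'" "q \<notin> A'" using ab gp gq by (auto simp: A'_def)
  ultimately show thesis using that by blast
qed

lemma gap_imp_not_connectedin:
  fixes p q :: "'a::linordered_field"
  assumes "is_gap (A :: 'a set)" "p \<in> C" "q \<in> C" "p < q"
  shows "\<not> connectedin interval_topology C"
proof -
  obtain A' where A': "is_gap A'" "p \<in> A'" "q \<notin> A'"
    using gap_between assms by blast
  show ?thesis
    unfolding connectedin_interval_topology not_not
    using A' assms interval_open_gap[OF A'(1)] interval_open_compl_gap[OF A'(1)]
    by (intro exI[of _ "A' \<inter> C"] exI[of _ "-A' \<inter> C"]) auto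
qed

lemma connectedin_imp_cut_axiom:
  fixes C :: "'a::linordered_field set"
  assumes "connectedin interval_topology C" "p \<in> C" "q \<in> C" "p < q"
  shows "cut_axiom TYPE('a)"
  using assms gap_imp_not_connectedin unfolding cut_axiom_def by blast

lemma not_totally_disconnected_iff:
  fixes S :: "'a::linordered_field set"
  shows "\<not> totally_disconnected S \<longleftrightarrow>
    (\<exists>C\<subseteq>S. connectedin interval_topology C \<and> (\<exists>p\<in>C. \<exists>q\<in>C. p < q))"
proof -
  have "C \<noteq> {} \<and> \<not> is_singleton C \<longleftrightarrow> (\<exists>p\<in>C. \<exists>q\<in>C. p < q)" for C :: "'a set"
    by (metis is_singletonI' empty_iff is_singletonE less_irrefl linorder_neqE singletonD)
  then show ?thesis unfolding totally_disconnected_def by metis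
qed

lemma cut_axiomE:
  assumes "cut_axiom TYPE('a::linordered_field)" "is_cut (A :: 'a set)"
  obtains c where "\<And>a. a \<in> A \<Longrightarrow> a \<le> c" "\<And>b. b \<notin> A \<Longrightarrow> c \<le> b"
proof -
  obtain c where c: "\<forall>a\<in>A. \<forall>b\<in>-A. c \<in> {a..b}"
    using assms unfolding cut_axiom_def is_gap_def by blast
  obtain a0 b0 where "a0 \<in> A" "b0 \<in> -A" using assms(2) unfolding is_cut_def by blast
  then show thesis using c by (intro that[of c]) auto
qed

text \<open>
  The cut consists of the points up to which, starting from \<open>a\<close>, one stays in the first piece. If the
  point \<open>c\<close> that fills it belonged to the first piece, one could stay there a little beyond \<open>c\<close>; if
  it belonged to the second, one would have left the first piece before \<open>c\<close>.
\<close>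

lemma cut_axiom_imp_no_separation:
  fixes I :: "'a::linordered_field set"
  assumes ca: "cut_axiom TYPE('a)" and "interval_set I"
    and G: "interval_open G" and H: "interval_open H"
    and disj: "G \<inter> I \<inter> H = {}" and cover: "I \<subseteq> G \<union> H"
    and a: "a \<in> G \<inter> I" and b: "b \<in> H \<inter> I"
  shows "\<not> a < b"
proof
  assume "a < b"
  then have I: "{a..b} \<subseteq> I" using assms(2) a b unfolding interval_set_def by blast
  \<comment> \<open>Points below \<open>a\<close> are in \<open>D\<close> vacuously; this makes \<open>D\<close> a cut of the whole field.\<close>
  define D where "D = {x. \<forall>y. a \<le> y \<and> y \<le> x \<longrightarrow> y \<in> G}"
  have aD: "a \<in> D" using a by (auto simp: D_def dest: antisym)
  have bD: "b \<notin> D" 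
  proof
    assume "b \<in> D"
    then have "b \<in> G" using \<open>a < b\<close> by (auto simp: D_def)
    then show False using b disj by blast
  qed
  have "is_cut D"
    unfolding is_cut_def
  proof (intro conjI ballI)
    show "D \<noteq> {}" "D \<noteq> UNIV" using aD bD by auto
    fix x y assume "x \<in> D" "y \<in> -D"
    then show "x < y" unfolding D_def using order_trans not_le by fastforce
  qed
  then obtain c where c: "\<And>x. x \<in> D \<Longrightarrow> x \<le> c" "\<And>y. y \<notin> D \<Longrightarrow> c \<le> y"
    using cut_axiomE[OF ca] by blast
  have ac: "a \<le> c" and cb: "c \<le> b" using c aD bD by auto
  have below: "y \<in> G" if "a \<le> y" "y < c" for y
    using that c(2)[of y] unfolding D_def by fastforce
  have "c \<in> G \<or> c \<in> H" using I ac cb cover by auto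
  then show False
  proof
    assume cG: "c \<in> G"
    then have "c < b" using cb b disj by (metis Int_iff emptyE order_le_less)
    obtain l r where lr: "c \<in> {l<..<r}" "{l<..<r} \<subseteq> G"
      using G cG unfolding interval_open_def by blast
    obtain m where m: "c < m" "m < r" using lr(1) dense by auto
    have "m \<in> D"
      unfolding D_def
    proof (intro CollectI allI impI)
      fix y assume y: "a \<le> y \<and> y \<le> m"
      show "y \<in> G"
      proof (cases "y < c")
        case True then show ?thesis using below y by blast
      next
        case False then show ?thesis using y lr m by (intro subsetD[OF lr(2)]) auto
      qed
    qed
    then show False using c(1) m(1) by fastforce
  next
    assume cH: "c \<in> H"
    have "c \<in> I" using I ac cb by auto
    then have "a < c" using ac cH a disj by (metis Int_iff emptyE order_le_less)
    obtain l r where lr: "c \<in> {l<..<r}" "{l<..<r} \<subseteq> H"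
      using H cH unfolding interval_open_def by blast
    then obtain y where y: "max a l < y" "y < c" using \<open>a < c\<close> dense[of "max a l" c] by auto
    then have "y \<in> G" using below by auto
    moreover have "y \<in> H" using y lr by (intro subsetD[OF lr(2)]) auto
    moreover have "y \<in> I" using y cb I by auto
    ultimately show False using disj by blast
  qed
qed

lemma cut_axiom_imp_interval_connected:
  fixes I :: "'a::linordered_field set"
  assumes "cut_axiom TYPE('a)" "interval_set I"
  shows "connectedin interval_topology I"
  unfolding connectedin_interval_topology
proof
  assume "\<exists>A B. A \<noteq> {} \<and> B \<noteq> {} \<and> A \<inter> B = {} \<and> I = A \<union> B \<and>
    (\<exists>G. interval_open G \<and> A = G \<inter> I) \<and> (\<exists>H. interval_open H \<and> B = H \<inter> I)"
  then obtain G H where *: "G \<inter> I \<noteq> {}" "H \<inter> I \<noteq> {}" "(G \<inter> I) \<inter> (H \<inter> I) = {}"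
    "I = G \<inter> I \<union> H \<inter> I" "interval_open G" "interval_open H"
    by metis
  then obtain a b where ab: "a \<in> G \<inter> I" "b \<in> H \<inter> I" by blast
  have "\<not> a < b"
    by (rule cut_axiom_imp_no_separation[OF assms *(5,6) _ _ ab]) (use * in blast)+
  moreover have "\<not> b < a"
    by (rule cut_axiom_imp_no_separation[OF assms *(6,5) _ _ ab(2,1)]) (use * in blast)+
  moreover have "a \<noteq> b" using ab * by blast
  ultimately show False by auto
qed

section \<open>The intermediate value theorem\<close>

lemma relatively_openI:
  fixes I :: "'a::linordered_field set"
  assumes "U \<subseteq> I"
    and "\<And>c. c \<in> U \<Longrightarrow> \<exists>\<delta>>0. \<forall>x\<in>I. \<bar>x - c\<bar> < \<delta> \<longrightarrow> x \<in> U"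
  shows "\<exists>G. interval_open G \<and> U = G \<inter> I"
proof -
  \<comment> \<open>The largest open set with trace inside \<open>U\<close>; taking all intervals avoids choosing a \<open>\<delta>\<close> for
    each point.\<close>
  define G where "G = \<Union>{J. (\<exists>l r. J = {l<..<r}) \<and> J \<inter> I \<subseteq> U}"
  have "interval_open G" unfolding interval_open_def G_def by blast
  moreover have "c \<in> G" if c: "c \<in> U" for c
  proof -
    obtain \<delta> where "\<delta> > 0" "\<forall>x\<in>I. \<bar>x - c\<bar> < \<delta> \<longrightarrow> x \<in> U"
      using assms(2) c by blast
    moreover from this have "{c - \<delta><..<c + \<delta>} \<inter> I \<subseteq> U"
      by (auto simp: abs_less_iff algebra_simps)
    ultimately show ?thesis unfolding G_def
      by (intro UnionI[of "{c - \<delta><..<c + \<delta>}"]) auto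
  qed
  then have "U = G \<inter> I" using assms(1) unfolding G_def by blast
  ultimately show ?thesis by blast
qed

lemma connectedin_imp_attains_between:
  fixes f :: "'a::linordered_field \<Rightarrow> 'a"
  assumes conn: "connectedin interval_topology I" and f: "field_continuous_on I f"
    and "a \<in> I" "b \<in> I" "f a < k" "k < f b"
  shows "\<exists>c\<in>I. f c = k"
proof (rule ccontr)
  assume omit: "\<not> (\<exists>c\<in>I. f c = k)"
  have "\<exists>G. interval_open G \<and> {x\<in>I. f x < k} = G \<inter> I"
  proof (rule relatively_openI)
    fix c assume c: "c \<in> {x\<in>I. f x < k}"
    then obtain \<delta> where "\<delta> > 0" "\<forall>x\<in>I. \<bar>x - c\<bar> < \<delta> \<longrightarrow> \<bar>f x - f c\<bar> < k - f c"
      using f unfolding field_continuous_on_def by force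
    then show "\<exists>\<delta>>0. \<forall>x\<in>I. \<bar>x - c\<bar> < \<delta> \<longrightarrow> x \<in> {x\<in>I. f x < k}"
      by (intro exI[of _ \<delta>]) (auto simp: abs_less_iff)
  qed auto
  moreover have "\<exists>G. interval_open G \<and> {x\<in>I. k < f x} = G \<inter> I"
  proof (rule relatively_openI)
    fix c assume c: "c \<in> {x\<in>I. k < f x}"
    then obtain \<delta> where "\<delta> > 0" "\<forall>x\<in>I. \<bar>x - c\<bar> < \<delta> \<longrightarrow> \<bar>f x - f c\<bar> < f c - k"
      using f unfolding field_continuous_on_def by force
    then show "\<exists>\<delta>>0. \<forall>x\<in>I. \<bar>x - c\<bar> < \<delta> \<longrightarrow> x \<in> {x\<in>I. k < f x}"
      by (intro exI[of _ \<delta>]) (auto simp: abs_less_iff)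
  qed auto
  moreover have "{x\<in>I. f x < k} \<noteq> {}" "{x\<in>I. k < f x} \<noteq> {}"
    using assms by auto
  moreover have "{x\<in>I. f x < k} \<inter> {x\<in>I. k < f x} = {}" by auto
  moreover have "I = {x\<in>I. f x < k} \<union> {x\<in>I. k < f x}"
    using omit by (auto simp: neq_iff)
  ultimately have "\<exists>A B. A \<noteq> {} \<and> B \<noteq> {} \<and> A \<inter> B = {} \<and> I = A \<union> B \<and>
      (\<exists>G. interval_open G \<and> A = G \<inter> I) \<and> (\<exists>G. interval_open G \<and> B = G \<inter> I)"
    by (intro exI[of _ "{x\<in>I. f x < k}"] exI[of _ "{x\<in>I. k < f x}"]) auto
  then show False
    using conn unfolding connectedin_interval_topology by (rule notE[rotated])
qed

lemma intervals_connected_imp_intermediate_value_theorem: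
  assumes "\<forall>I :: 'a::linordered_field set. interval_set I \<longrightarrow> connectedin interval_topology I"
  shows "intermediate_value_theorem TYPE('a)"
  unfolding intermediate_value_theorem_def
proof (intro allI impI)
  fix a b k :: 'a and f
  assume *: "a \<le> b \<and> field_continuous_on {a..b} f \<and> f a < k \<and> k < f b"
  have "connectedin interval_topology {a..b}"
    using assms unfolding interval_set_def by auto
  then show "\<exists>c\<in>{a..b}. f c = k"
    by (rule connectedin_imp_attains_between[where a = a and b = b]) (use * in auto)
qed

text \<open>
  Both sides of a gap being open, the indicator function of its upper side is locally constant,
  hence continuous, but it does not take the value \<open>1/2\<close>.
\<close>

lemma intermediate_value_theorem_imp_cut_axiom:
  assumes ivt: "intermediate_value_theorem TYPE('a::linordered_field)"
  shows "cut_axiom TYPE('a)"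
  unfolding cut_axiom_def
proof (intro allI impI notI)
  fix A :: "'a set" assume "is_cut A" and gap: "is_gap A"
  then obtain a b where ab: "a \<in> A" "b \<notin> A" "a \<le> b"
    unfolding is_cut_def by (metis ComplI UNIV_eq_I ex_in_conv less_imp_le)
  define f where "f x = (if x \<in> A then 0 else 1 :: 'a)" for x
  have "field_continuous_on {a..b} f"
    unfolding field_continuous_on_def
  proof (intro ballI allI impI)
    fix c \<epsilon> :: 'a assume "\<epsilon> > 0"
    obtain l r where lr: "c \<in> {l<..<r}" "\<And>x. x \<in> {l<..<r} \<Longrightarrow> x \<in> A \<longleftrightarrow> c \<in> A"
      using interval_open_gap[OF gap] interval_open_compl_gap[OF gap]
      unfolding interval_open_def by (metis ComplD ComplI subsetD)
    show "\<exists>\<delta>>0. \<forall>x\<in>{a..b}. \<bar>x - c\<bar> < \<delta> \<longrightarrow> \<bar>f x - f c\<bar> < \<epsilon>"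
    proof (intro exI[of _ "min (c - l) (r - c)"] conjI ballI impI)
      show "min (c - l) (r - c) > 0" using lr(1) by auto
      fix x assume "\<bar>x - c\<bar> < min (c - l) (r - c)"
      then have "x \<in> {l<..<r}" by (auto simp: abs_less_iff)
      then have "f x = f c" using lr(2) by (simp add: f_def)
      then show "\<bar>f x - f c\<bar> < \<epsilon>" using \<open>\<epsilon> > 0\<close> by simp
    qed
  qed
  moreover have "f a < 1/2" "1/2 < f b" using ab by (auto simp: f_def)
  ultimately obtain c where "f c = 1/2"
    using ivt ab(3) unfolding intermediate_value_theorem_def by blast
  then show False by (auto simp: f_def split: if_splits)
qed

section \<open>Suprema, monotone sequences and nested intervals\<close>

lemma cut_axiom_imp_existence_of_suprema:
  assumes ca: "cut_axiom TYPE('a::linordered_field)"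
  shows "existence_of_suprema TYPE('a)"
  unfolding existence_of_suprema_def
proof (intro allI impI)
  fix S :: "'a set" assume S: "S \<noteq> {} \<and> (\<exists>b. isUb UNIV S b)"
  then obtain s0 u where s0: "s0 \<in> S" and u: "\<And>s. s \<in> S \<Longrightarrow> s \<le> u"
    by (auto simp: isUb_def setle_def)
  \<comment> \<open>The elements that are not upper bounds of \<open>S\<close>. Since the order is dense, a point above all of
    them is an upper bound.\<close>
  define A where "A = {x. \<exists>s\<in>S. x < s}"
  have "is_cut A"
    unfolding is_cut_def
  proof (intro conjI ballI)
    obtain t where "t < s0" using lt_ex by blast
    then show "A \<noteq> {}" using s0 unfolding A_def by blast
    have "u \<notin> A" using u by (auto simp: A_def not_less)
    then show "A \<noteq> UNIV" by blast
    fix x y assume "x \<in> A" "y \<in> -A"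
    then show "x < y" by (force simp: A_def)
  qed
  then obtain c where c: "\<And>a. a \<in> A \<Longrightarrow> a \<le> c" "\<And>b. b \<notin> A \<Longrightarrow> c \<le> b"
    using cut_axiomE[OF ca] by blast
  have "s \<le> c" if "s \<in> S" for s
  proof (rule ccontr)
    assume "\<not> s \<le> c"
    then obtain m where "c < m" "m < s" using dense[of c s] by auto
    then have "m \<in> A" using that by (auto simp: A_def)
    then show False using c(1)[of m] \<open>c < m\<close> by simp
  qed
  moreover have "c \<le> v" if "\<And>s. s \<in> S \<Longrightarrow> s \<le> v" for v
  proof (rule c(2))
    show "v \<notin> A" using that by (auto simp: A_def not_less)
  qed
  ultimately have "isLub UNIV S c"
    by (auto simp: isLub_def leastP_def isUb_def setle_def setge_def)
  then show "\<exists>c. isLub UNIV S c" by blast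
qed

lemma existence_of_suprema_imp_monotone_convergence_principle:
  assumes es: "existence_of_suprema TYPE('a::linordered_field)"
  shows "monotone_convergence_principle TYPE('a)"
  unfolding monotone_convergence_principle_def
proof (intro allI impI)
  fix c :: "nat \<Rightarrow> 'a" assume c: "(\<forall>n. c n \<le> c (Suc n)) \<and> (\<exists>M. \<forall>n. c n \<le> M)"
  then have mono: "c m \<le> c n" if "m \<le> n" for m n
    using that by (blast intro: lift_Suc_mono_le)
  have "\<exists>b. isUb UNIV (range c) b" using c by (auto simp: isUb_def setle_def)
  then obtain l where l: "isLub UNIV (range c) l"
    using es unfolding existence_of_suprema_def by blast
  then have ub: "\<And>n. c n \<le> l" and least: "\<And>v. (\<And>n. c n \<le> v) \<Longrightarrow> l \<le> v"
    by (auto simp: isLub_def leastP_def isUb_def setle_def setge_def)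
  have "\<exists>N. \<forall>n\<ge>N. \<bar>c n - l\<bar> < \<epsilon>" if "\<epsilon> > 0" for \<epsilon>
  proof -
    have "\<not> l \<le> l - \<epsilon>" using that by simp
    then have "\<not> (\<forall>n. c n \<le> l - \<epsilon>)" using least by blast
    then obtain N where N: "l - \<epsilon> < c N" by (auto simp: not_le)
    have "\<bar>c n - l\<bar> < \<epsilon>" if "n \<ge> N" for n
      using N mono[OF that] ub[of n] by (auto simp: abs_if algebra_simps)
    then show ?thesis by blast
  qed
  then show "\<exists>l. converges_to c l" unfolding converges_to_def by blast
qed

lemma monotone_convergence_principle_imp_archimedean_principle:
  assumes mcp: "monotone_convergence_principle TYPE('a::linordered_field)"
  shows "archimedean_principle TYPE('a)"
  unfolding archimedean_principle_def
proof (intro allI impI)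
  fix x y :: 'a assume "x > 0 \<and> y > 0"
  then have pos: "x / y > 0" by simp
  have "\<exists>N::nat. of_nat N > x / y"
  proof (rule ccontr)
    assume "\<not> (\<exists>N::nat. of_nat N > x / y)"
    then have "\<forall>n. of_nat n \<le> x / y" by (simp add: not_less)
    then obtain l :: 'a where "converges_to of_nat l"
      using mcp unfolding monotone_convergence_principle_def by (metis of_nat_mono le_SucI order_refl)
    then obtain N where N: "\<And>n. n \<ge> N \<Longrightarrow> \<bar>of_nat n - l\<bar> < 1/2"
      unfolding converges_to_def by (metis half_gt_zero zero_less_one)
    \<comment> \<open>Consecutive integers cannot both lie within \<open>1/2\<close> of \<open>l\<close>.\<close>
    have "\<bar>of_nat N - l\<bar> < 1/2" "\<bar>of_nat N + 1 - l\<bar> < 1/2"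
      using N[of N] N[of "Suc N"] by (simp_all add: algebra_simps)
    then show False by (auto simp: abs_less_iff)
  qed
  then obtain N :: nat where "of_nat N > x / y" by blast
  moreover from this have "N \<noteq> 0" using pos by (auto dest: less_trans)
  ultimately show "\<exists>N::nat. N \<ge> 1 \<and> of_nat N > x / y"
    by (intro exI[of _ N]) auto
qed

lemma nested_intervals_endpoints_le:
  assumes "nested_intervals a b"
  shows "a m \<le> b n"
proof -
  have *: "a k \<le> a (Suc k)" "b (Suc k) \<le> b k" "a k \<le> b k" for k
    using assms unfolding nested_intervals_def by auto
  have "a m \<le> a (max m n)" using lift_Suc_mono_le[of a, OF *(1)] by simp
  also have "\<dots> \<le> b (max m n)" by (rule *(3))
  also have "\<dots> \<le> b n" using lift_Suc_antimono_le[of b, OF *(2)] by simp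
  finally show ?thesis .
qed

lemma incseq_converges_to_le:
  fixes c :: "nat \<Rightarrow> 'a::linordered_field"
  assumes lim: "converges_to c l" and mono: "\<And>n. c n \<le> c (Suc n)"
  shows "c n \<le> l"
proof (rule ccontr)
  assume "\<not> c n \<le> l"
  then obtain N where N: "\<And>m. m \<ge> N \<Longrightarrow> \<bar>c m - l\<bar> < c n - l"
    using lim unfolding converges_to_def by (metis diff_gt_0_iff_gt not_le)
  have "c n \<le> c (max n N)" by (rule lift_Suc_mono_le[of c, OF mono]) auto
  then show False using N[of "max n N"] by (auto simp: abs_less_iff)
qed

lemma converges_to_upper_bound:
  fixes c :: "nat \<Rightarrow> 'a::linordered_field"
  assumes lim: "converges_to c l" and ub: "\<And>n. c n \<le> u"
  shows "l \<le> u"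
proof (rule ccontr)
  assume "\<not> l \<le> u"
  then obtain N where "\<bar>c N - l\<bar> < l - u"
    using lim unfolding converges_to_def by (metis diff_gt_0_iff_gt not_le order_refl)
  then show False using ub[of N] by (auto simp: abs_less_iff)
qed

lemma monotone_convergence_principle_imp_weak_nested_intervals_principle:
  assumes mcp: "monotone_convergence_principle TYPE('a::linordered_field)"
  shows "weak_nested_intervals_principle TYPE('a)"
  unfolding weak_nested_intervals_principle_def
proof (intro allI impI)
  fix a b :: "nat \<Rightarrow> 'a"
  assume "nested_intervals a b \<and> converges_to (\<lambda>k. b k - a k) 0"
  then have nested: "nested_intervals a b" by blast
  then have mono: "a k \<le> a (Suc k)" for k
    unfolding nested_intervals_def by auto
  have le: "a m \<le> b n" for m n by (rule nested_intervals_endpoints_le[OF nested])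
  obtain l where l: "converges_to a l"
    using mcp mono le[of _ 0] unfolding monotone_convergence_principle_def by blast
  have "l \<in> {a k..b k}" for k
    using incseq_converges_to_le[OF l mono] converges_to_upper_bound[OF l le] by auto
  then show "(\<Inter>k. {a k..b k}) \<noteq> {}" by blast
qed

lemma archimedean_principle_imp_halving_tendsto_0:
  fixes d :: "'a::linordered_field"
  assumes ap: "archimedean_principle TYPE('a)" and "d > 0"
  shows "converges_to (\<lambda>k. d / 2 ^ k) 0"
  unfolding converges_to_def
proof (intro allI impI)
  fix \<epsilon> :: 'a assume "\<epsilon> > 0"
  then obtain N :: nat where N: "of_nat N > d / \<epsilon>"
    using ap \<open>d > 0\<close> unfolding archimedean_principle_def by blast
  have "\<bar>d / 2 ^ n - 0\<bar> < \<epsilon>" if "n \<ge> N" for n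
  proof -
    have "N < 2 ^ n" using that less_exp[of n] by linarith
    then have "of_nat N < (2 ^ n :: 'a)" by (metis of_nat_less_iff of_nat_numeral of_nat_power)
    then have "d / \<epsilon> < 2 ^ n" using N by (rule less_trans[rotated])
    then show ?thesis using \<open>\<epsilon> > 0\<close> \<open>d > 0\<close> by (simp add: field_simps)
  qed
  then show "\<exists>N. \<forall>n\<ge>N. \<bar>d / 2 ^ n - 0\<bar> < \<epsilon>" by blast
qed

text \<open>
  Bisection: replacing one endpoint by the midpoint, according to the side of the cut on which the
  midpoint lies, keeps the left endpoint in the cut and the right one outside.
\<close>

lemma cut_bisection:
  fixes A :: "'a::linordered_field set"
  assumes "is_cut A"
  obtains a b where "nested_intervals a b" "\<And>k. a k \<in> A" "\<And>k. b k \<notin> A"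
    "\<And>k. b k - a k = (b 0 - a 0) / 2 ^ k"
proof -
  let ?P = "\<lambda>p::'a \<times> 'a. fst p \<in> A \<and> snd p \<notin> A"
  let ?Q = "\<lambda>p q::'a \<times> 'a. fst p \<le> fst q \<and> snd q \<le> snd p \<and>
              snd q - fst q = (snd p - fst p) / 2"
  have less: "x < y" if "x \<in> A" "y \<notin> A" for x y
    using assms that unfolding is_cut_def by blast
  have "\<exists>f. \<forall>n. ?P (f n) \<and> ?Q (f n) (f (Suc n))"
  proof (rule dependent_nat_choice[where P = "\<lambda>_. ?P" and Q = "\<lambda>_. ?Q"])
    show "\<exists>p. ?P p" using assms unfolding is_cut_def by auto
    fix p :: "'a \<times> 'a" and n :: nat assume p: "?P p"
    then have lt: "fst p < snd p" using less by blast
    define m where "m = (fst p + snd p) / 2"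
    have m: "fst p \<le> m" "m \<le> snd p" "snd p - m = (snd p - fst p) / 2" "m - fst p = (snd p - fst p) / 2"
      using lt by (auto simp: m_def field_simps)
    show "\<exists>q. ?P q \<and> ?Q p q"
    proof (cases "m \<in> A")
      case True
      then show ?thesis using p m by (intro exI[of _ "(m, snd p)"]) auto
    next
      case False
      then show ?thesis using p m by (intro exI[of _ "(fst p, m)"]) auto
    qed
  qed
  then obtain f where P: "\<And>n. ?P (f n)" and Q: "\<And>n. ?Q (f n) (f (Suc n))" by blast
  have len: "snd (f k) - fst (f k) = (snd (f 0) - fst (f 0)) / 2 ^ k" for k
  proof (induction k)
    case (Suc k)
    then show ?case using Q[of k] by (simp add: mult.commute)
  qed simp
  have "nested_intervals (fst \<circ> f) (snd \<circ> f)"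
    unfolding nested_intervals_def using P Q less by (auto intro: less_imp_le order_trans)
  then show thesis
  proof (rule that)
    fix k
    show "(fst \<circ> f) k \<in> A" "(snd \<circ> f) k \<notin> A" using P by simp_all
    show "(snd \<circ> f) k - (fst \<circ> f) k = ((snd \<circ> f) 0 - (fst \<circ> f) 0) / 2 ^ k"
      using len[of k] by (simp only: o_apply)
  qed
qed

lemma archimedean_weak_nested_imp_cut_axiom:
  assumes ap: "archimedean_principle TYPE('a::linordered_field)"
    and nip: "weak_nested_intervals_principle TYPE('a)"
  shows "cut_axiom TYPE('a)"
  unfolding cut_axiom_def
proof (intro allI impI notI)
  fix A :: "'a set" assume cut: "is_cut A" and gap: "is_gap A"
  obtain a b where nested: "nested_intervals a b" and ab: "\<And>k. a k \<in> A" "\<And>k. b k \<notin> A"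
    and len: "\<And>k. b k - a k = (b 0 - a 0) / 2 ^ k"
    using cut_bisection[OF cut] by blast
  have less: "x < y" if "x \<in> A" "y \<notin> A" for x y
    using cut that unfolding is_cut_def by blast
  have "b 0 - a 0 > 0" using less[OF ab] by simp
  then have "converges_to (\<lambda>k. (b 0 - a 0) / 2 ^ k) 0"
    by (rule archimedean_principle_imp_halving_tendsto_0[OF ap])
  also have "(\<lambda>k. (b 0 - a 0) / 2 ^ k) = (\<lambda>k. b k - a k)"
    using len[symmetric] by (rule ext)
  finally have lim: "converges_to (\<lambda>k. b k - a k) 0" .
  then have "(\<Inter>k. {a k..b k}) \<noteq> {}"
    using nip nested unfolding weak_nested_intervals_principle_def by blast
  then obtain c where "c \<in> (\<Inter>k. {a k..b k})" by blast
  then have c: "a k \<le> c" "c \<le> b k" for k by auto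
  have short: "\<exists>k. b k - a k < \<epsilon>" if "\<epsilon> > 0" for \<epsilon>
    using lim that unfolding converges_to_def by (metis abs_less_iff diff_zero order_refl)
  \<comment> \<open>In a gap there is room beyond \<open>c\<close> on its own side, so a short interval around \<open>c\<close> would lie
    on that side entirely.\<close>
  show False
  proof (cases "c \<in> A")
    case True
    then obtain x where x: "x \<in> A" "c < x" using gap_greater_in gap by blast
    then obtain k where "b k - a k < x - c" using short[of "x - c"] by auto
    then have "b k < x" using c(1)[of k] by simp
    then show False using less[OF x(1) ab(2)[of k]] by simp
  next
    case False
    then obtain x where x: "x \<notin> A" "x < c" using gap_less_out gap by blast
    then obtain k where "b k - a k < c - x" using short[of "c - x"] by auto
    then have "x < a k" using c(2)[of k] by simp
    then show False using less[OF ab(1)[of k] x(1)] by simp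
  qed
qed

section \<open>Equivalence of the completeness principles\<close>

theorem theorem79:
  shows
   "((archimedean_principle TYPE('a::linordered_field) \<and>
      weak_nested_intervals_principle TYPE('a))
       \<longleftrightarrow> existence_of_suprema TYPE('a)) \<and>
    (existence_of_suprema TYPE('a)
       \<longleftrightarrow> connectedin interval_topology {0..1::'a}) \<and>
    (connectedin interval_topology {0..1::'a}
       \<longleftrightarrow> \<not> totally_disconnected (UNIV :: 'a set)) \<and>
    (\<not> totally_disconnected (UNIV :: 'a set)
       \<longleftrightarrow> (\<forall>I :: 'a set. interval_set I \<longrightarrow> connectedin interval_topology I)) \<and>
    ((\<forall>I :: 'a set. interval_set I \<longrightarrow> connectedin interval_topology I)
       \<longleftrightarrow> intermediate_value_theorem TYPE('a)) \<and>
    (intermediate_value_theorem TYPE('a)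
       \<longleftrightarrow> connectedin interval_topology (UNIV :: 'a set)) \<and>
    (connectedin interval_topology (UNIV :: 'a set)
       \<longleftrightarrow> cut_axiom TYPE('a)) \<and>
    (cut_axiom TYPE('a)
       \<longleftrightarrow> monotone_convergence_principle TYPE('a))"
proof -
  let ?CA = "cut_axiom TYPE('a)"
  let ?intervals = "\<forall>I :: 'a set. interval_set I \<longrightarrow> connectedin interval_topology I"
  have order: "?CA \<Longrightarrow> existence_of_suprema TYPE('a)"
    "existence_of_suprema TYPE('a) \<Longrightarrow> monotone_convergence_principle TYPE('a)"
    "monotone_convergence_principle TYPE('a) \<Longrightarrow>
       archimedean_principle TYPE('a) \<and> weak_nested_intervals_principle TYPE('a)"
    "archimedean_principle TYPE('a) \<and> weak_nested_intervals_principle TYPE('a) \<Longrightarrow> ?CA"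
    using cut_axiom_imp_existence_of_suprema
      existence_of_suprema_imp_monotone_convergence_principle
      monotone_convergence_principle_imp_archimedean_principle
      monotone_convergence_principle_imp_weak_nested_intervals_principle
      archimedean_weak_nested_imp_cut_axiom
    by blast+
  have intervals: "?CA \<Longrightarrow> ?intervals"
    using cut_axiom_imp_interval_connected by blast
  have unit: "?intervals \<Longrightarrow> connectedin interval_topology {0..1::'a}"
    and line: "?intervals \<Longrightarrow> connectedin interval_topology (UNIV :: 'a set)"
    by (simp_all add: interval_set_def)
  have "(0::'a) \<in> {0..1}" "(1::'a) \<in> {0..1}" "(0::'a) < 1" by auto
  then have not_td: "connectedin interval_topology {0..1::'a} \<Longrightarrow>
      \<not> totally_disconnected (UNIV :: 'a set)"
    unfolding not_totally_disconnected_iff by blast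
  have td_CA: "\<not> totally_disconnected (UNIV :: 'a set) \<Longrightarrow> ?CA"
    unfolding not_totally_disconnected_iff using connectedin_imp_cut_axiom by blast
  have line_CA: "connectedin interval_topology (UNIV :: 'a set) \<Longrightarrow> ?CA"
    using connectedin_imp_cut_axiom[of UNIV 0 1] by simp
  have ivt: "?intervals \<Longrightarrow> intermediate_value_theorem TYPE('a)"
    by (rule intervals_connected_imp_intermediate_value_theorem)
  have ivt_CA: "intermediate_value_theorem TYPE('a) \<Longrightarrow> ?CA"
    by (rule intermediate_value_theorem_imp_cut_axiom)
  show ?thesis
    using order intervals unit line not_td td_CA line_CA ivt ivt_CA by satx
qed

end
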